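(* Let $B$ be a real or complex Banach space, let $(b_j)$ be an (s.s.) sequence in $B$, and let $(b_j^* )$ be the functionals in $[b_j]^*$ biorthogonal to $(b_j)$. Then $\bigl(\sum_{j=1}^n b_j^*\bigr)_{n=1}^\infty$ is a non-trivial weak-Cauchy sequence in $[b_j]^*$; hence $[b_j]^*$ is not weakly sequentially complete.
   Context: $[b_j]$ denotes the closed linear span of $(b_j)$. A sequence in a Banach space $X$ is weak-Cauchy if $\lim_j x^*(x_j)$ exists for all $x^*\in X^*$; it is non-trivial if it is not weakly convergent. A Banach space is weakly sequentially complete if every weak-Cauchy sequence in it converges weakly. A basic sequence is a sequence that is a Schauder basis of its closed linear span; its biorthogonal functionals are given by $b_j^*(b_i)=\delta_{ij}$. A sequence $(b_j)$ is strongly summing (s.s.) if it is a weak-Cauchy basic sequence such that whenever scalars $(c_j)$ satisfy $\sup_n\|\sum_{j=1}^n c_jb_j\|<\infty$, the series $\sum c_j$ converges. *)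

theory Defs
  imports "HOL-Analysis.Analysis"
begin

text \<open>
  Spaces over a scalar field \<open>'k\<close>, used below with \<open>real\<close> and \<open>complex\<close>. The ambient
  Banach space is a type of class \<^class>\<open>banach\<close> with a scalar multiplication \<open>smul\<close>:
  \<^const>\<open>scaleR\<close> in the real case, and in the complex case any map satisfying the
  locale below. Completeness does not depend on the scalars.
\<close>

locale normed_scaling = vector_space smul
  for smul :: "'k::real_normed_field \<Rightarrow> 'a::real_normed_vector \<Rightarrow> 'a" +
  assumes norm_scale: "norm (smul c x) = norm c * norm x"
    and scale_of_real: "smul (of_real r) x = r *\<^sub>R x"

text \<open>
  The dual of \<open>[b\<^sub>j]\<close> is the dual of a subset of a type and its elements are functions, so
  normed spaces are also represented by records with an explicit carrier.
\<close>

record ('k, 'v) nspace =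
  pts :: "'v set"
  vadd :: "'v \<Rightarrow> 'v \<Rightarrow> 'v"
  vscale :: "'k \<Rightarrow> 'v \<Rightarrow> 'v"
  vnorm :: "'v \<Rightarrow> real"

definition space_on :: "('k \<Rightarrow> 'a \<Rightarrow> 'a) \<Rightarrow> 'a set \<Rightarrow> ('k, 'a::real_normed_vector) nspace" where
  "space_on smul S = \<lparr>pts = S, vadd = (+), vscale = smul, vnorm = norm\<rparr>"

text \<open>
  Functionals are set to \<open>0\<close> outside the carrier: each functional on the carrier is then
  represented by exactly one function, and pointwise sums stay in the dual.
\<close>

definition bounded_functional ::
    "('k::real_normed_field, 'v) nspace \<Rightarrow> ('v \<Rightarrow> 'k) \<Rightarrow> bool" where
  "bounded_functional X f \<longleftrightarrow>
     (\<forall>x\<in>pts X. \<forall>y\<in>pts X. f (vadd X x y) = f x + f y) \<and>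
     (\<forall>c. \<forall>x\<in>pts X. f (vscale X c x) = c * f x) \<and>
     (\<exists>K. \<forall>x\<in>pts X. norm (f x) \<le> K * vnorm X x) \<and>
     (\<forall>x. x \<notin> pts X \<longrightarrow> f x = 0)"

definition dual ::
    "('k::real_normed_field, 'v) nspace \<Rightarrow> ('k, 'v \<Rightarrow> 'k) nspace" where
  "dual X =
     \<lparr>pts = {f. bounded_functional X f},
      vadd = (\<lambda>f g x. f x + g x),
      vscale = (\<lambda>c f x. c * f x),
      vnorm = (\<lambda>f. SUP x\<in>{x\<in>pts X. vnorm X x \<le> 1}. norm (f x))\<rparr>"

definition weak_Cauchy :: "('k::real_normed_field, 'v) nspace \<Rightarrow> (nat \<Rightarrow> 'v) \<Rightarrow> bool" where
  "weak_Cauchy X x \<longleftrightarrow>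
     range x \<subseteq> pts X \<and> (\<forall>f\<in>pts (dual X). convergent (\<lambda>n. f (x n)))"

definition weakly_convergent :: "('k::real_normed_field, 'v) nspace \<Rightarrow> (nat \<Rightarrow> 'v) \<Rightarrow> bool" where
  "weakly_convergent X x \<longleftrightarrow>
     range x \<subseteq> pts X \<and> (\<exists>l\<in>pts X. \<forall>f\<in>pts (dual X). (\<lambda>n. f (x n)) \<longlonglongrightarrow> f l)"

definition nontrivial_weak_Cauchy ::
    "('k::real_normed_field, 'v) nspace \<Rightarrow> (nat \<Rightarrow> 'v) \<Rightarrow> bool" where
  "nontrivial_weak_Cauchy X x \<longleftrightarrow> weak_Cauchy X x \<and> \<not> weakly_convergent X x"

definition weakly_sequentially_complete :: "('k::real_normed_field, 'v) nspace \<Rightarrow> bool" where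
  "weakly_sequentially_complete X \<longleftrightarrow> (\<forall>x. weak_Cauchy X x \<longrightarrow> weakly_convergent X x)"

definition closed_span ::
    "('k::real_normed_field \<Rightarrow> 'a \<Rightarrow> 'a) \<Rightarrow> (nat \<Rightarrow> 'a::real_normed_vector) \<Rightarrow> 'a set" where
  "closed_span smul b = closure (module.span smul (range b))"

definition basic_sequence ::
    "('k::real_normed_field \<Rightarrow> 'a \<Rightarrow> 'a) \<Rightarrow> (nat \<Rightarrow> 'a::real_normed_vector) \<Rightarrow> bool" where
  "basic_sequence smul b \<longleftrightarrow>
     (\<forall>x\<in>closed_span smul b. \<exists>!c. (\<lambda>j. smul (c j) (b j)) sums x)"

definition strongly_summing ::
    "('k::real_normed_field \<Rightarrow> 'a \<Rightarrow> 'a) \<Rightarrow> (nat \<Rightarrow> 'a::real_normed_vector) \<Rightarrow> bool" where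
  "strongly_summing smul b \<longleftrightarrow>
     weak_Cauchy (space_on smul UNIV) b \<and>
     basic_sequence smul b \<and>
     (\<forall>c. bdd_above (range (\<lambda>n. norm (\<Sum>j\<le>n. smul (c j) (b j)))) \<longrightarrow> summable c)"

definition dual_closed_span ::
    "('k::real_normed_field \<Rightarrow> 'a \<Rightarrow> 'a) \<Rightarrow> (nat \<Rightarrow> 'a::real_normed_vector)
      \<Rightarrow> ('k, 'a \<Rightarrow> 'k) nspace" where
  "dual_closed_span smul b = dual (space_on smul (closed_span smul b))"

definition biorthogonal_functionals ::
    "('k::real_normed_field \<Rightarrow> 'a \<Rightarrow> 'a) \<Rightarrow> (nat \<Rightarrow> 'a::real_normed_vector)
      \<Rightarrow> (nat \<Rightarrow> 'a \<Rightarrow> 'k) \<Rightarrow> bool" where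
  "biorthogonal_functionals smul b b' \<longleftrightarrow>
     range b' \<subseteq> pts (dual_closed_span smul b) \<and>
     (\<forall>i j. b' j (b i) = (if i = j then 1 else 0))"

end

theory Submission
  imports Defs
begin

text \<open>
  Let \<open>P\<^sub>n\<close> be the basis projections and \<open>s\<^sub>n\<close> the partial sums of the \<open>b\<^sub>j\<^sup>*\<close>. For \<open>F\<close> in the
  bidual and a functional \<open>g\<close> norming \<open>y = \<Sum>j\<le>n. F(b\<^sub>j\<^sup>*) b\<^sub>j\<close>, one has
  \<open>g(y) = F(\<Sum>j\<le>n. g(b\<^sub>j) b\<^sub>j\<^sup>*) = F(g \<circ> P\<^sub>n)\<close>, so \<open>\<parallel>y\<parallel>\<close> is bounded by \<open>\<parallel>F\<parallel>\<close> times the basis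
  constant; the (s.s.) property then gives convergence of \<open>F(s\<^sub>n) = \<Sum>j\<le>n. F(b\<^sub>j\<^sup>*)\<close>. A weak
  limit \<open>l\<close> of \<open>s\<^sub>n\<close> would satisfy \<open>l(b\<^sub>i) = 1\<close> for all \<open>i\<close>, but \<open>f \<mapsto> lim f(b\<^sub>j)\<close>, which is a bounded
  functional because \<open>(b\<^sub>j)\<close> is weak-Cauchy, vanishes on every \<open>s\<^sub>n\<close>. The ingredients are the
  Hahn-Banach theorem over both scalar fields and two applications of the Baire category
  theorem: one bounds \<open>(b\<^sub>j)\<close>, the other bounds the projections and so also shows that the
  biorthogonal functionals exist.
\<close>

subsection \<open>The Hahn-Banach theorem\<close>

text \<open>
  Functionals on subspaces are represented by their graphs. Domination by \<open>p\<close> makes a subspace of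
  the product single-valued: \<open>(0, t)\<close> and \<open>(0, - t)\<close> in it give \<open>t \<le> 0\<close> and \<open>- t \<le> 0\<close>.
\<close>

lemma sublinear_one_step_extension:
  fixes p :: "'a::real_vector \<Rightarrow> real"
  assumes p_add: "\<And>x y. p (x + y) \<le> p x + p y"
    and p_scale: "\<And>t x. 0 < t \<Longrightarrow> p (t *\<^sub>R x) = t * p x"
    and G: "subspace G" and G_le: "\<And>x t. (x, t) \<in> G \<Longrightarrow> t \<le> p x"
  obtains H a where "subspace H" "G \<subseteq> H" "(z, a) \<in> H" "\<And>x t. (x, t) \<in> H \<Longrightarrow> t \<le> p x"
proof -
  \<comment> \<open>\<open>L\<close> collects the lower bounds on the value at \<open>z\<close> that
    domination at the points \<open>x - z\<close> imposes; \<open>sep\<close> puts each below every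
    upper bound \<open>p (y + z) - s\<close>, so any value in between serves and the least one is
    taken.\<close>
  define L where "L = (\<lambda>(x, t). t - p (x - z)) ` G"
  have sep: "t - p (x - z) \<le> p (y + z) - s" if "(x, t) \<in> G" "(y, s) \<in> G" for x t y s
  proof -
    have "(x + y, t + s) \<in> G"
      using subspace_add[OF G that] by simp
    then have "t + s \<le> p ((x - z) + (y + z))"
      using G_le by fastforce
    also have "\<dots> \<le> p (x - z) + p (y + z)"
      by (rule p_add)
    finally show ?thesis
      by simp
  qed
  have zero: "(0, 0) \<in> G"
    using subspace_0[OF G] by (simp add: zero_prod_def)
  then have "L \<noteq> {}"
    by (auto simp: L_def)
  have "bdd_above L"
    using sep[OF _ zero] by (intro bdd_aboveI[of _ "p z"]) (auto simp: L_def)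
  define a where "a = Sup L"
  have lower: "t - p (x - z) \<le> a" if "(x, t) \<in> G" for x t
    unfolding a_def using that \<open>bdd_above L\<close>
    by (intro cSup_upper) (auto simp: L_def)
  have upper: "a \<le> p (y + z) - s" if "(y, s) \<in> G" for y s
    unfolding a_def using that \<open>L \<noteq> {}\<close> sep
    by (intro cSup_least) (auto simp: L_def)
  define H where "H = {u + v | u v. u \<in> G \<and> v \<in> span {(z, a)}}"
  have "subspace H"
    unfolding H_def by (intro subspace_sums G subspace_span)
  moreover have "G \<subseteq> H"
  proof
    fix u assume "u \<in> G"
    then have "u + 0 \<in> H"
      unfolding H_def using span_zero by blast
    then show "u \<in> H"
      by simp
  qed
  moreover have "(z, a) \<in> H"
  proof -
    have "0 + (z, a) \<in> H"
      unfolding H_def using subspace_0[OF G] span_base[of "(z, a)" "{(z, a)}"] by blast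
    then show ?thesis
      by simp
  qed
  moreover have "t \<le> p x" if xt: "(x, t) \<in> H" for x t
  proof -
    from xt obtain y s r where ys: "(y, s) \<in> G" and x: "x = y + r *\<^sub>R z" and t: "t = s + r * a"
      unfolding H_def span_singleton by auto
    \<comment> \<open>Positive homogeneity reduces the coefficient \<open>r\<close> to its sign:
      dividing by its modulus leads to \<open>y + z\<close>, handled by \<open>upper\<close>, or to
      \<open>y - z\<close>, handled by \<open>lower\<close>.\<close>
    consider "r = 0" | "r > 0" | "r < 0"
      by linarith
    then show ?thesis
    proof cases
      case 1
      then show ?thesis
        using G_le[OF ys] x t by simp
    next
      case 2
      have "((1 / r) *\<^sub>R y, (1 / r) * s) \<in> G"
        using subspace_scale[OF G ys, of "1 / r"] by simp
      from upper[OF this] have "r * a \<le> r * p ((1 / r) *\<^sub>R y + z) - s"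
        using 2 by (simp add: field_simps)
      also have "r * p ((1 / r) *\<^sub>R y + z) = p x"
        using 2 by (simp add: p_scale[symmetric] x algebra_simps)
      finally show ?thesis
        using t by simp
    next
      case 3
      have "((1 / - r) *\<^sub>R y, (1 / - r) * s) \<in> G"
        using subspace_scale[OF G ys, of "1 / - r"] by simp
      from lower[OF this] have "s \<le> - r * a + - r * p ((1 / - r) *\<^sub>R y - z)"
        using 3 by (simp add: field_simps)
      also have "- r * p ((1 / - r) *\<^sub>R y - z) = p x"
        using 3 by (subst p_scale[symmetric]) (simp_all add: x algebra_simps)
      finally show ?thesis
        using t by simp
    qed
  qed
  ultimately show thesis
    using that by blast
qed

text \<open>Zorn's lemma yields a maximal dominated graph containing that of \<open>f\<close>; if it
  missed a point \<open>z\<close> of the space, the one-step extension would enlarge it.\<close>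

theorem real_Hahn_Banach:
  fixes p :: "'a::real_vector \<Rightarrow> real"
  assumes p_add: "\<And>x y. p (x + y) \<le> p x + p y"
    and p_scale: "\<And>t x. 0 \<le> t \<Longrightarrow> p (t *\<^sub>R x) = t * p x"
    and M: "subspace M"
    and f_add: "\<And>x y. x \<in> M \<Longrightarrow> y \<in> M \<Longrightarrow> f (x + y) = f x + f y"
    and f_scale: "\<And>r x. x \<in> M \<Longrightarrow> f (r *\<^sub>R x) = r * f x"
    and f_le: "\<And>x. x \<in> M \<Longrightarrow> f x \<le> p x"
  obtains g where "linear g" "\<And>x. x \<in> M \<Longrightarrow> g x = f x" "\<And>x. g x \<le> p x"
proof -
  define G0 where "G0 = (\<lambda>x. (x, f x)) ` M"
  define F where "F = {G. subspace G \<and> G0 \<subseteq> G \<and> (\<forall>(x, t)\<in>G. t \<le> p x)}"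
  have "f 0 = 0"
    using f_scale[OF subspace_0[OF M], of 0] by simp
  have "subspace G0"
    unfolding G0_def subspace_def using M \<open>f 0 = 0\<close>
    by (auto simp: image_iff zero_prod_def f_add f_scale subspace_0 subspace_add subspace_scale)
  then have "G0 \<in> F"
    by (auto simp: F_def G0_def f_le)
  have "\<exists>G\<in>F. \<forall>H\<in>F. G \<subseteq> H \<longrightarrow> H = G"
  proof (rule subset_Zorn_nonempty)
    show "F \<noteq> {}"
      using \<open>G0 \<in> F\<close> by blast
    fix C assume "C \<noteq> {}" and chain: "subset.chain F C"
    have CF: "C \<subseteq> F"
      using chain by (simp add: subset_chain_def)
    have "subspace (\<Union>C)"
      unfolding subspace_def
    proof (intro conjI allI ballI)
      show "0 \<in> \<Union>C"
        using \<open>C \<noteq> {}\<close> CF by (fastforce simp: F_def subspace_0)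
      show "u + v \<in> \<Union>C" if uv: "u \<in> \<Union>C" "v \<in> \<Union>C" for u v
      proof -
        from uv obtain X Y where X: "X \<in> C" "u \<in> X" and Y: "Y \<in> C" "v \<in> Y"
          by blast
        have "X \<union> Y \<in> C"
          using chain X(1) Y(1) by (metis subset_chain_def sup.absorb1 sup.absorb2)
        moreover have "subspace (X \<union> Y)"
          using calculation CF by (auto simp: F_def)
        ultimately show ?thesis
          using X Y by (meson UnI1 UnI2 UnionI subspace_add)
      qed
      show "r *\<^sub>R u \<in> \<Union>C" if "u \<in> \<Union>C" for r u
      proof -
        from that obtain X where "X \<in> C" "u \<in> X"
          by blast
        moreover from this have "subspace X"
          using CF by (auto simp: F_def)
        ultimately show ?thesis
          using subspace_scale by blast
      qed
    qed
    then show "\<Union>C \<in> F"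
      using \<open>C \<noteq> {}\<close> CF by (fastforce simp: F_def)
  qed
  then obtain G where "G \<in> F" and G_max: "\<And>H. H \<in> F \<Longrightarrow> G \<subseteq> H \<Longrightarrow> H = G"
    by blast
  then have G: "subspace G" and G0: "G0 \<subseteq> G" and G_le: "\<And>x t. (x, t) \<in> G \<Longrightarrow> t \<le> p x"
    by (auto simp: F_def)
  have total: "\<exists>t. (z, t) \<in> G" for z
  proof -
    obtain H a where H: "subspace H" "G \<subseteq> H" "(z, a) \<in> H" "\<And>x t. (x, t) \<in> H \<Longrightarrow> t \<le> p x"
      using sublinear_one_step_extension[OF p_add p_scale G G_le, of z] by (metis less_imp_le)
    then have "H \<in> F"
      using G0 by (auto simp: F_def)
    then show ?thesis
      using G_max H by blast
  qed
  have "p 0 = 0"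
    using p_scale[of 0 0] by simp
  have unique: "t = s" if "(x, t) \<in> G" "(x, s) \<in> G" for x t s
  proof -
    have "(0, t - s) \<in> G" "(0, s - t) \<in> G"
      using subspace_diff[OF G that] subspace_diff[OF G that(2,1)] by simp_all
    then show ?thesis
      using G_le[of 0 "t - s"] G_le[of 0 "s - t"] \<open>p 0 = 0\<close> by simp
  qed
  define g where "g x = (THE t. (x, t) \<in> G)" for x
  have g_eq: "g x = t" if "(x, t) \<in> G" for x t
    unfolding g_def using that unique by blast
  have g_in: "(x, g x) \<in> G" for x
    using total g_eq by blast
  show thesis
  proof
    show "linear g"
    proof (rule linearI)
      show "g (x + y) = g x + g y" for x y
        using subspace_add[OF G g_in g_in, of x y] by (intro g_eq) simp
      show "g (r *\<^sub>R x) = r *\<^sub>R g x" for r x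
        using subspace_scale[OF G g_in, of r x] by (intro g_eq) simp
    qed
    show "g x = f x" if "x \<in> M" for x
      using that G0 by (intro g_eq) (auto simp: G0_def)
    show "g x \<le> p x" for x
      by (rule G_le[OF g_in])
  qed
qed

corollary norm_Hahn_Banach:
  fixes f :: "'a::real_normed_vector \<Rightarrow> real"
  assumes "subspace M" and "0 \<le> K"
    and "\<And>x y. x \<in> M \<Longrightarrow> y \<in> M \<Longrightarrow> f (x + y) = f x + f y"
    and "\<And>r x. x \<in> M \<Longrightarrow> f (r *\<^sub>R x) = r * f x"
    and "\<And>x. x \<in> M \<Longrightarrow> \<bar>f x\<bar> \<le> K * norm x"
  obtains g where "linear g" "\<And>x. x \<in> M \<Longrightarrow> g x = f x" "\<And>x. \<bar>g x\<bar> \<le> K * norm x"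
proof -
  have "K * norm (x + y) \<le> K * norm x + K * norm y" for x y :: 'a
    using mult_left_mono[OF norm_triangle_ineq \<open>0 \<le> K\<close>] by (simp add: distrib_left)
  moreover have "f x \<le> K * norm x" if "x \<in> M" for x
    using assms(5)[OF that] by simp
  ultimately obtain g where g: "linear g" "\<And>x. x \<in> M \<Longrightarrow> g x = f x" and le: "\<And>x. g x \<le> K * norm x"
    using assms by (elim real_Hahn_Banach[of "\<lambda>x. K * norm x" M f, rotated -1]) auto
  have "\<bar>g x\<bar> \<le> K * norm x" for x
    using le[of x] le[of "- x"] linear_neg[OF g(1), of x] by simp
  then show thesis
    using that g by blast
qed

text \<open>On the line through \<open>y\<close>, the functional with value \<open>norm y\<close> at
  \<open>y\<close> has bound 1, and Hahn-Banach extends it with the same bound.\<close>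

lemma norming_functional:
  fixes y :: "'a::real_normed_vector"
  obtains u :: "'a \<Rightarrow> real" where "linear u" "u y = norm y" "\<And>x. \<bar>u x\<bar> \<le> norm x"
proof (cases "y = 0")
  case True
  then show thesis
    using that[of "\<lambda>_. 0"] by (simp add: linear_zero)
next
  case False
  \<comment> \<open>This \<open>f\<close> carries no bound away from the line; only its restriction
    to \<open>span {y}\<close> is used.\<close>
  obtain f :: "'a \<Rightarrow> real" where f: "linear f" "f y = norm y"
    using linear_independent_extend[of "{y}" "\<lambda>_. norm y"] False by auto
  have f_bound: "\<bar>f x\<bar> \<le> 1 * norm x" if "x \<in> span {y}" for x
    using that f by (auto simp: span_singleton linear_scale abs_mult)
  obtain u where u: "linear u" "\<And>x. x \<in> span {y} \<Longrightarrow> u x = f x" "\<And>x. \<bar>u x\<bar> \<le> 1 * norm x"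
    by (rule norm_Hahn_Banach[of "span {y}" 1 f]) (use f f_bound in \<open>auto simp: linear_add linear_scale\<close>)
  then show thesis
    using that[of u] f by (auto simp: span_base)
qed

subsection \<open>Consequences of the Baire category theorem\<close>

text \<open>Baire's theorem in the complete space \<open>S\<close> gives a ball around some
  \<open>x\<close> in the closure of one \<open>A n\<close>. Since \<open>y\<close> is the midpoint
  of \<open>x + y\<close> and \<open>- (x - y)\<close>, symmetry and convexity move the ball to the
  origin.\<close>

lemma Baire_symmetric_convex:
  fixes A :: "nat \<Rightarrow> 'a::banach set"
  assumes "closed S" "subspace S" and cover: "S \<subseteq> (\<Union>n. A n)"
    and conv: "\<And>n. convex (A n)" and symm: "\<And>n x. x \<in> A n \<Longrightarrow> - x \<in> A n"
  obtains n r where "0 < r" "cball 0 r \<inter> S \<subseteq> closure (A n)"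
proof -
  have "0 \<in> S"
    using \<open>subspace S\<close> by (rule subspace_0)
  have "\<exists>n. top_of_set S interior_of (S \<inter> closure (A n)) \<noteq> {}"
  proof (rule ccontr)
    assume "\<not> ?thesis"
    then have "top_of_set S interior_of \<Union>(range (\<lambda>n. S \<inter> closure (A n))) = {}"
      using \<open>closed S\<close>
      by (intro Baire_category_alt)
        (auto intro: completely_metrizable_space_closedin completely_metrizable_space_euclidean
          closedin_closed_Int)
    moreover have "\<Union>(range (\<lambda>n. S \<inter> closure (A n))) = S"
      using cover closure_subset by blast
    ultimately show False
      using \<open>0 \<in> S\<close> interior_of_topspace[of "top_of_set S"] by simp
  qed
  then obtain n x where x: "x \<in> top_of_set S interior_of (S \<inter> closure (A n))"
    by blast
  then obtain T where "open T" "x \<in> T" "x \<in> S" and T: "S \<inter> T \<subseteq> closure (A n)"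
    unfolding interior_of_def openin_open by blast
  then obtain r where "0 < r" and r: "cball x r \<subseteq> T"
    using open_contains_cball by blast
  have symm_closure: "- y \<in> closure (A n)" if "y \<in> closure (A n)" for y
  proof -
    have "uminus ` closure (A n) \<subseteq> closure (uminus ` A n)"
      by (intro closure_bounded_linear_image_subset bounded_linear_minus bounded_linear_ident)
    also have "\<dots> \<subseteq> closure (A n)"
      using symm by (intro closure_mono) blast
    finally show ?thesis
      using that by blast
  qed
  have "y \<in> closure (A n)" if "y \<in> cball 0 r \<inter> S" for y
  proof -
    have "x + y \<in> closure (A n)" "x - y \<in> closure (A n)"
      using that T r \<open>x \<in> S\<close> \<open>subspace S\<close>
      by (auto intro!: subsetD[OF T] subsetD[OF r] simp: subspace_add subspace_diff dist_norm)
    then have "(1/2) *\<^sub>R (x + y) + (1/2) *\<^sub>R (- (x - y)) \<in> closure (A n)"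
      by (intro convexD convex_closure conv symm_closure) auto
    also have "(1/2) *\<^sub>R (x + y) + (1/2) *\<^sub>R (- (x - y)) = y"
      by (simp add: algebra_simps flip: scaleR_add_left)
    finally show ?thesis .
  qed
  then show thesis
    using that \<open>0 < r\<close> by blast
qed

text \<open>Uniform boundedness for the evaluations at \<open>b n\<close> on the space of bounded
  real functionals, which is complete even if \<open>'a\<close> is not. Norming functionals bring
  the bound back to the vectors.\<close>

lemma weakly_bounded_imp_bounded:
  fixes b :: "nat \<Rightarrow> 'a::real_normed_vector"
  assumes "\<And>u :: 'a \<Rightarrow> real. bounded_linear u \<Longrightarrow> bounded (range (\<lambda>n. u (b n)))"
  shows "bounded (range b)"
proof -
  define A where "A m = {u :: 'a \<Rightarrow>\<^sub>L real. \<forall>n. \<bar>blinfun_apply u (b n)\<bar> \<le> real m}" for m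
  have A_INT: "A m = (\<Inter>n. (\<lambda>u. blinfun_apply u (b n)) -` cball 0 (real m))" for m
    by (auto simp: A_def)
  have cover: "UNIV \<subseteq> (\<Union>m. A m)"
  proof
    fix u :: "'a \<Rightarrow>\<^sub>L real"
    obtain K where "\<And>n. \<bar>blinfun_apply u (b n)\<bar> \<le> K"
      using assms[OF blinfun.bounded_linear_right[of u]] by (auto simp: bounded_iff)
    then show "u \<in> (\<Union>m. A m)"
      using order_trans[OF _ real_nat_ceiling_ge[of K]] by (auto simp: A_def)
  qed
  have "convex (A m)" for m
    unfolding A_INT
    by (intro convex_INT convex_linear_vimage convex_cball)
      (simp add: blinfun.bounded_linear_left bounded_linear.linear)
  moreover have "closed (A m)" for m
    unfolding A_INT
    by (intro closed_INT ballI continuous_closed_vimage closed_cball)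
      (simp add: blinfun.bounded_linear_left linear_continuous_at)
  ultimately obtain m r where "0 < r" and r: "cball 0 r \<subseteq> A m"
    by (rule_tac Baire_symmetric_convex[of UNIV A])
      (use cover in \<open>auto simp: A_def blinfun.minus_left\<close>)
  have "norm (b n) \<le> m / r" for n
  proof -
    obtain u :: "'a \<Rightarrow> real" where u: "linear u" "u (b n) = norm (b n)" "\<And>x. \<bar>u x\<bar> \<le> norm x"
      using norming_functional[of "b n"] by blast
    have bl: "bounded_linear u"
      using u by (intro bounded_linear_intro[where K = 1]) (auto simp: linear_add linear_scale)
    have "norm (Blinfun u) \<le> 1"
      using u bl by (intro norm_blinfun_bound) (auto simp: bounded_linear_Blinfun_apply)
    \<comment> \<open>Scaling the norming functional into the ball of radius \<open>r\<close>
      produces the bound \<open>m / r\<close>.\<close>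
    then have "r *\<^sub>R Blinfun u \<in> cball 0 r"
      using \<open>0 < r\<close> by (simp add: mult_left_le)
    then have "\<bar>blinfun_apply (r *\<^sub>R Blinfun u) (b n)\<bar> \<le> m"
      using subsetD[OF r] unfolding A_def by blast
    then have "r * norm (b n) \<le> m"
      using u bl \<open>0 < r\<close> by (simp add: blinfun.scaleR_left bounded_linear_Blinfun_apply abs_mult)
    then show ?thesis
      using \<open>0 < r\<close> by (simp add: field_simps)
  qed
  then show ?thesis
    by (auto simp: bounded_iff)
qed

text \<open>Successive approximation as in the open mapping theorem: approximate within
  \<open>r / 2\<close>, double the remainder so that it fits the ball again, and repeat. This
  replaces the closure of \<open>A\<close> by series of elements of \<open>A\<close>.\<close>

lemma halving_expansion:
  fixes S :: "'a::real_normed_vector set"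
  assumes "subspace S" "A \<subseteq> S" "0 < r" and dense: "cball 0 r \<inter> S \<subseteq> closure A"
    and x: "x \<in> S" "norm x \<le> r"
  obtains a where "\<And>k. a k \<in> A" "(\<lambda>k. (1/2) ^ k *\<^sub>R a k) sums x"
proof -
  have "\<exists>a\<in>A. norm (y - a) \<le> r / 2" if "y \<in> S" "norm y \<le> r" for y
  proof -
    have "y \<in> closure A"
      using dense that by auto
    then obtain a where "a \<in> A" "dist a y < r / 2"
      using \<open>0 < r\<close> by (meson closure_approachable half_gt_zero)
    then show ?thesis
      by (intro bexI[of _ a]) (auto simp: dist_norm norm_minus_commute)
  qed
  then obtain p where p: "\<And>y. y \<in> S \<Longrightarrow> norm y \<le> r \<Longrightarrow> p y \<in> A \<and> norm (y - p y) \<le> r / 2"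
    by metis
  \<comment> \<open>\<open>y k\<close> is the remainder after \<open>k\<close> steps, magnified by
    \<open>2 ^ k\<close>.\<close>
  define y where "y = rec_nat x (\<lambda>_ y. 2 *\<^sub>R (y - p y))"
  have y_0: "y 0 = x" and y_Suc: "y (Suc k) = 2 *\<^sub>R (y k - p (y k))" for k
    by (simp_all add: y_def)
  have y: "y k \<in> S \<and> norm (y k) \<le> r" for k
  proof (induction k)
    case 0
    then show ?case
      using x by (simp add: y_0)
  next
    case (Suc k)
    then have "p (y k) \<in> A" "norm (y k - p (y k)) \<le> r / 2"
      using p by blast+
    then show ?case
      using Suc \<open>subspace S\<close> \<open>A \<subseteq> S\<close> by (auto simp: y_Suc intro!: subspace_scale subspace_diff)
  qed
  have partial: "(\<Sum>k<n. (1/2) ^ k *\<^sub>R p (y k)) = x - (1/2) ^ n *\<^sub>R y n" for n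
    by (induction n) (auto simp: y_0 y_Suc algebra_simps)
  have "(\<lambda>n. (1/2) ^ n *\<^sub>R y n) \<longlonglongrightarrow> 0"
  proof (rule Lim_null_comparison)
    show "\<forall>\<^sub>F n in sequentially. norm ((1/2) ^ n *\<^sub>R y n) \<le> (1/2) ^ n * r"
      using y by (auto intro!: always_eventually mult_left_mono)
    show "(\<lambda>n. (1/2) ^ n * r) \<longlonglongrightarrow> 0"
      by (intro tendsto_mult_left_zero LIMSEQ_power_zero) simp
  qed
  then have "(\<lambda>n. x - (1/2) ^ n *\<^sub>R y n) \<longlonglongrightarrow> x"
    using tendsto_diff[OF tendsto_const] by fastforce
  then have "(\<lambda>k. (1/2) ^ k *\<^sub>R p (y k)) sums x"
    by (simp add: sums_def partial)
  then show thesis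
    using that[of "\<lambda>k. p (y k)"] y p by blast
qed

subsection \<open>Basis projections\<close>

context normed_scaling
begin

lemma bounded_linear_smul_right: "bounded_linear (smul c)"
proof (rule bounded_linear_intro[where K = "norm c"])
  show "smul c (x + y) = smul c x + smul c y" for x y
    by (rule scale_right_distrib)
  show "smul c (r *\<^sub>R x) = r *\<^sub>R smul c x" for r x
    by (simp add: mult.commute flip: scale_of_real)
  show "norm (smul c x) \<le> norm x * norm c" for x
    by (simp add: norm_scale)
qed

lemma bounded_linear_smul_left: "bounded_linear (\<lambda>c. smul c x)"
proof (rule bounded_linear_intro[where K = "norm x"])
  show "smul (c + d) x = smul c x + smul d x" for c d
    by (rule scale_left_distrib)
  show "smul (r *\<^sub>R c) x = r *\<^sub>R smul c x" for r c
    by (simp add: scaleR_conv_of_real flip: scale_of_real)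
  show "norm (smul c x) \<le> norm c * norm x" for c
    by (simp add: norm_scale)
qed

text \<open>Inside the locale \<open>subspace\<close> refers to \<open>smul\<close>, whereas the
  Hahn-Banach and Baire lemmas above are stated for real subspaces.\<close>

lemma subspace_imp_real_subspace: "subspace V \<Longrightarrow> Real_Vector_Spaces.subspace V"
  unfolding subspace_def Real_Vector_Spaces.subspace_def by (metis scale_of_real)

lemma subspace_closure:
  assumes "subspace V"
  shows "subspace (closure V)"
  unfolding subspace_def
proof (intro conjI ballI allI)
  show "0 \<in> closure V"
    using subspace_0[OF assms] closure_subset by blast
  show "x + y \<in> closure V" if "x \<in> closure V" "y \<in> closure V" for x y
  proof -
    from that obtain f g where "\<And>n. f n \<in> V" "f \<longlonglongrightarrow> x" "\<And>n. g n \<in> V" "g \<longlonglongrightarrow> y"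
      unfolding closure_sequential by blast
    then show ?thesis
      unfolding closure_sequential
      by (intro exI[of _ "\<lambda>n. f n + g n"] conjI allI subspace_add[OF assms] tendsto_add) auto
  qed
  show "smul c x \<in> closure V" if "x \<in> closure V" for c x
  proof -
    have "smul c ` closure V \<subseteq> closure (smul c ` V)"
      by (rule closure_bounded_linear_image_subset[OF bounded_linear_smul_right])
    also have "\<dots> \<subseteq> closure V"
      using subspace_scale[OF assms] by (intro closure_mono) blast
    finally show ?thesis
      using that by blast
  qed
qed

end

section \<open>Expansion coefficients and partial-sum projections\<close>

locale basic_sequence_in_banach = normed_scaling smul
  for smul :: "'k::{real_normed_field, banach} \<Rightarrow> 'a::banach \<Rightarrow> 'a" +
  fixes b :: "nat \<Rightarrow> 'a"
  assumes basic: "basic_sequence smul b"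
begin

abbreviation "S \<equiv> closed_span smul b"

definition coef :: "'a \<Rightarrow> nat \<Rightarrow> 'k" where
  "coef x = (THE c. (\<lambda>j. smul (c j) (b j)) sums x)"

text \<open>The bound is strict, as in \<open>sums\<close>; a sum over \<open>j \<le> n\<close>
  therefore corresponds to \<open>proj (Suc n)\<close>.\<close>

definition proj :: "nat \<Rightarrow> 'a \<Rightarrow> 'a" where
  "proj n x = (\<Sum>j<n. smul (coef x j) (b j))"

lemma subspace_S: "subspace S"
  unfolding closed_span_def by (intro subspace_closure subspace_span)

lemma closed_S: "closed S"
  by (simp add: closed_span_def)

lemma b_in_S: "b j \<in> S"
  unfolding closed_span_def by (intro subsetD[OF closure_subset] span_base rangeI)

text \<open>Uniqueness of expansions is assumed only at points of \<open>S\<close>; this makes it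
  available for every convergent series.\<close>

lemma sums_in_S:
  assumes "(\<lambda>j. smul (c j) (b j)) sums x"
  shows "x \<in> S"
proof (rule closed_sequentially[OF closed_S])
  show "(\<Sum>j<n. smul (c j) (b j)) \<in> S" for n
    by (rule subspace_sum[OF subspace_S subspace_scale[OF subspace_S b_in_S]])
  show "(\<lambda>n. \<Sum>j<n. smul (c j) (b j)) \<longlonglongrightarrow> x"
    using assms by (simp add: sums_def)
qed

lemma coef_eqI:
  assumes "(\<lambda>j. smul (c j) (b j)) sums x"
  shows "coef x = c"
  unfolding coef_def
  using basic sums_in_S[OF assms] assms by (auto simp: basic_sequence_def)

lemma coef_sums:
  assumes "x \<in> S"
  shows "(\<lambda>j. smul (coef x j) (b j)) sums x"
proof -
  have "\<exists>!c. (\<lambda>j. smul (c j) (b j)) sums x"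
    using basic assms by (simp add: basic_sequence_def)
  from theI'[OF this] show ?thesis
    by (simp only: coef_def)
qed

lemma coef_add: "coef (x + y) j = coef x j + coef y j" if "x \<in> S" "y \<in> S"
proof -
  have "(\<lambda>j. smul (coef x j + coef y j) (b j)) sums (x + y)"
    using sums_add[OF coef_sums coef_sums] that by (simp add: scale_left_distrib)
  then show ?thesis
    by (rule fun_cong[OF coef_eqI])
qed

lemma coef_smul: "coef (smul c x) j = c * coef x j" if "x \<in> S"
proof -
  have "(\<lambda>j. smul (c * coef x j) (b j)) sums smul c x"
    using bounded_linear.sums[OF bounded_linear_smul_right coef_sums[OF that]] by simp
  then show ?thesis
    by (rule fun_cong[OF coef_eqI])
qed

lemma coef_b: "coef (b i) j = (if j = i then 1 else 0)"
proof -
  have "(\<lambda>j. smul (if j = i then 1 else 0) (b j)) sums b i"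
    using sums_single[of i b] by (rule sums_cong[THEN iffD1, rotated]) auto
  then show ?thesis
    by (rule fun_cong[OF coef_eqI])
qed

text \<open>If \<open>b j\<close> were zero, the zero coefficients would give it a second expansion.
  This permits division by \<open>norm (b j)\<close>.\<close>

lemma b_nonzero: "b j \<noteq> 0"
proof
  assume "b j = 0"
  then have "(\<lambda>i. smul (0 :: 'k) (b i)) sums b j"
    by simp
  then have "coef (b j) j = 0"
    by (rule fun_cong[OF coef_eqI])
  then show False
    by (simp add: coef_b)
qed

lemma proj_add: "x \<in> S \<Longrightarrow> y \<in> S \<Longrightarrow> proj n (x + y) = proj n x + proj n y"
  by (simp add: proj_def coef_add scale_left_distrib sum.distrib)

lemma proj_smul: "x \<in> S \<Longrightarrow> proj n (smul c x) = smul c (proj n x)"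
  by (simp add: proj_def coef_smul scale_sum_right)

lemma proj_scaleR: "x \<in> S \<Longrightarrow> proj n (r *\<^sub>R x) = r *\<^sub>R proj n x"
  using proj_smul[of x n "of_real r"] by (simp add: scale_of_real)

lemma proj_tendsto: "x \<in> S \<Longrightarrow> (\<lambda>n. proj n x) \<longlonglongrightarrow> x"
  using coef_sums by (simp add: proj_def sums_def)

text \<open>Each term of the expansion is a difference of consecutive projections, so bounds on
  projections control the coefficients.\<close>

lemma norm_coef_mult: "norm (coef x j) * norm (b j) \<le> norm (proj (Suc j) x) + norm (proj j x)"
proof -
  have "smul (coef x j) (b j) = proj (Suc j) x - proj j x"
    by (simp add: proj_def)
  then show ?thesis
    by (metis norm_scale norm_triangle_ineq4)
qed

text \<open>
  A series of vectors whose projections are uniformly small may be expanded termwise, since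
  Weierstrass' test interchanges the two limits; uniqueness of the expansion then identifies
  the projections of the sum.
\<close>

lemma proj_suminf:
  assumes a: "\<And>k. a k \<in> S" and bound: "\<And>k n. norm (proj n (a k)) \<le> m"
    and x: "(\<lambda>k. (1/2) ^ k *\<^sub>R a k) sums x"
  shows "norm (proj n x) \<le> 2 * m"
proof -
  define f where "f k n = (1/2) ^ k *\<^sub>R proj n (a k)" for k n
  \<comment> \<open>The sum of the weights from \<open>k = 0\<close> on is 2, whence the factor in
    the conclusion.\<close>
  have geometric: "(\<lambda>k. (1/2) ^ k * C) sums (2 * C)" for C :: real
    using sums_mult2[OF geometric_sums[of "1/2 :: real"], of C] by simp
  have f_bound: "norm (f k n) \<le> (1/2) ^ k * m" for k n
    using bound by (simp add: f_def)
  have uniform: "uniform_limit UNIV (\<lambda>N n. \<Sum>k<N. f k n) (\<lambda>n. \<Sum>k. f k n) sequentially"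
    using f_bound sums_summable[OF geometric] by (intro Weierstrass_m_test)
  have tendsto: "(\<lambda>n. \<Sum>k. f k n) \<longlonglongrightarrow> x"
  proof (rule swap_uniform_limit'[OF _ _ uniform])
    show "\<forall>\<^sub>F N in sequentially. (\<lambda>n. \<Sum>k<N. f k n) \<longlonglongrightarrow> (\<Sum>k<N. (1/2) ^ k *\<^sub>R a k)"
      unfolding f_def by (intro always_eventually allI tendsto_sum tendsto_scaleR tendsto_const proj_tendsto a)
    show "(\<lambda>N. \<Sum>k<N. (1/2) ^ k *\<^sub>R a k) \<longlonglongrightarrow> x"
      using x by (simp add: sums_def)
  qed auto
  \<comment> \<open>The candidate coefficients of \<open>x\<close>. For each fixed \<open>j\<close>
    the series converges, because the projection bound makes \<open>coef (a k) j\<close> bounded in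
    \<open>k\<close>.\<close>
  define c where "c j = (\<Sum>k. (1/2) ^ k *\<^sub>R coef (a k) j)" for j
  have c: "(\<lambda>k. (1/2) ^ k *\<^sub>R coef (a k) j) sums c j" for j
  proof -
    have "norm (coef (a k) j) * norm (b j) \<le> 2 * m" for k
      using norm_coef_mult[of "a k" j] bound[of j k] bound[of "Suc j" k] by linarith
    then have "norm (coef (a k) j) \<le> 2 * m / norm (b j)" for k
      using b_nonzero by (simp add: field_simps)
    then have "norm ((1/2) ^ k *\<^sub>R coef (a k) j) \<le> (1/2) ^ k * (2 * m / norm (b j))" for k
      by (simp add: mult_left_mono del: times_divide_eq_right)
    then have "summable (\<lambda>k. (1/2) ^ k *\<^sub>R coef (a k) j)"
      by (intro summable_comparison_test'[OF sums_summable[OF geometric]])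
    then show ?thesis
      by (simp add: c_def summable_sums)
  qed
  have f_sums: "(\<lambda>k. f k n) sums (\<Sum>j<n. smul (c j) (b j))" for n
  proof -
    have "(\<lambda>k. \<Sum>j<n. smul ((1/2) ^ k *\<^sub>R coef (a k) j) (b j)) sums (\<Sum>j<n. smul (c j) (b j))"
      by (intro sums_sum bounded_linear.sums[OF bounded_linear_smul_left c])
    moreover have "(\<Sum>j<n. smul ((1/2) ^ k *\<^sub>R coef (a k) j) (b j)) = f k n" for k
      by (simp add: f_def proj_def scaleR_sum_right
          linear_scale[OF bounded_linear.linear[OF bounded_linear_smul_left]])
    ultimately show ?thesis
      by simp
  qed
  have "(\<lambda>j. smul (c j) (b j)) sums x"
    using tendsto by (simp add: sums_def sums_unique[OF f_sums, symmetric])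
  then have "proj n x = (\<Sum>k. f k n)"
    by (simp add: proj_def coef_eqI sums_unique[OF f_sums, symmetric])
  also have "norm \<dots> \<le> (\<Sum>k. (1/2) ^ k * m)"
    using f_bound sums_summable[OF geometric] by (intro norm_suminf_le)
  also have "\<dots> = 2 * m"
    by (rule sums_unique[OF geometric, symmetric])
  finally show ?thesis .
qed

text \<open>The projections of each point converge, so the sets \<open>A m\<close> cover
  \<open>S\<close>. They are not known to be closed, as continuity of the projections is the very
  claim; the expansion by halving passes from the closure of \<open>A m\<close> to the ball at the
  cost of a factor 2.\<close>

theorem proj_bounded:
  obtains M where "0 \<le> M" "\<And>n x. x \<in> S \<Longrightarrow> norm (proj n x) \<le> M * norm x"
proof -
  define A where "A m = {x \<in> S. \<forall>n. norm (proj n x) \<le> real m}" for m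
  note real_S = subspace_imp_real_subspace[OF subspace_S]
  have "S \<subseteq> (\<Union>m. A m)"
  proof
    fix x assume "x \<in> S"
    then have "Bseq (\<lambda>n. proj n x)"
      using proj_tendsto convergent_imp_Bseq convergentI by blast
    then obtain K where "\<And>n. norm (proj n x) \<le> K"
      by (auto simp: Bseq_def)
    then show "x \<in> (\<Union>m. A m)"
      using order_trans[OF _ real_nat_ceiling_ge[of K]] \<open>x \<in> S\<close> by (auto simp: A_def)
  qed
  moreover have "convex (A m)" for m
  proof (rule convexI)
    fix x y and u v :: real
    assume xy: "x \<in> A m" "y \<in> A m" and uv: "0 \<le> u" "0 \<le> v" "u + v = 1"
    have "norm (proj n (u *\<^sub>R x + v *\<^sub>R y)) \<le> m" for n
    proof -
      have "proj n (u *\<^sub>R x + v *\<^sub>R y) = u *\<^sub>R proj n x + v *\<^sub>R proj n y"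
        using xy real_S by (simp add: A_def proj_add proj_scaleR real_vector.subspace_scale)
      moreover have "u *\<^sub>R proj n x + v *\<^sub>R proj n y \<in> cball 0 (real m)"
        using xy uv by (intro convexD[OF convex_cball]) (auto simp: A_def)
      ultimately show ?thesis
        by simp
    qed
    then show "u *\<^sub>R x + v *\<^sub>R y \<in> A m"
      using xy real_S
      by (auto simp: A_def intro!: real_vector.subspace_add real_vector.subspace_scale)
  qed
  moreover have "- x \<in> A m" if "x \<in> A m" for x m
    using that proj_scaleR[of x _ "- 1"] real_S
    by (auto simp: A_def real_vector.subspace_neg)
  ultimately obtain m r where "0 < r" and r: "cball 0 r \<inter> S \<subseteq> closure (A m)"
    by (rule Baire_symmetric_convex[OF closed_S real_S])
  have small: "norm (proj n x) \<le> 2 * real m" if x: "x \<in> S" "norm x \<le> r" for n x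
  proof -
    have "A m \<subseteq> S"
      by (auto simp: A_def)
    then obtain a where a: "\<And>k. a k \<in> A m" "(\<lambda>k. (1/2) ^ k *\<^sub>R a k) sums x"
      using halving_expansion[OF real_S _ \<open>0 < r\<close> r x] by blast
    then show ?thesis
      by (intro proj_suminf[of a]) (auto simp: A_def)
  qed
  show thesis
  proof
    show "norm (proj n x) \<le> (2 * real m / r) * norm x" if "x \<in> S" for n x
    proof (cases "x = 0")
      case True
      then show ?thesis
        using proj_scaleR[OF that, of n 0] by simp
    next
      case False
      have "norm (proj n ((r / norm x) *\<^sub>R x)) \<le> 2 * real m"
        using that \<open>0 < r\<close> False real_S by (intro small real_vector.subspace_scale) auto
      then show ?thesis
        using that \<open>0 < r\<close> False by (simp add: proj_scaleR field_simps)
    qed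
  qed (use \<open>0 < r\<close> in simp)
qed

section \<open>Existence and uniqueness of the biorthogonal functionals\<close>

lemma bounded_functional_S_iff:
  "f \<in> pts (dual_closed_span smul b) \<longleftrightarrow>
    (\<forall>x\<in>S. \<forall>y\<in>S. f (x + y) = f x + f y) \<and> (\<forall>c. \<forall>x\<in>S. f (smul c x) = c * f x) \<and>
    (\<exists>K. \<forall>x\<in>S. norm (f x) \<le> K * norm x) \<and> (\<forall>x. x \<notin> S \<longrightarrow> f x = 0)"
  by (simp add: dual_closed_span_def dual_def bounded_functional_def space_on_def)

lemma bounded_functional_S_I:
  assumes "\<And>x y. x \<in> S \<Longrightarrow> y \<in> S \<Longrightarrow> f (x + y) = f x + f y"
    and "\<And>c x. x \<in> S \<Longrightarrow> f (smul c x) = c * f x"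
    and "\<And>x. x \<in> S \<Longrightarrow> norm (f x) \<le> K * norm x"
    and "\<And>x. x \<notin> S \<Longrightarrow> f x = 0"
  shows "f \<in> pts (dual_closed_span smul b)"
  using assms unfolding bounded_functional_S_iff by blast

text \<open>Without existence, a statement about all biorthogonal families could not refute weak
  sequential completeness. Boundedness of the coordinate functionals comes from
  \<open>proj_bounded\<close>.\<close>

lemma ex_biorthogonal_functionals: "\<exists>b'. biorthogonal_functionals smul b b'"
proof -
  obtain M where M: "0 \<le> M" "\<And>n x. x \<in> S \<Longrightarrow> norm (proj n x) \<le> M * norm x"
    using proj_bounded by blast
  define b' where "b' j x = (if x \<in> S then coef x j else 0)" for j x
  have bound: "norm (b' j x) \<le> (2 * M / norm (b j)) * norm x" if "x \<in> S" for j x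
  proof -
    have "norm (coef x j) * norm (b j) \<le> 2 * M * norm x"
      using norm_coef_mult[of x j] M(2)[OF that, of j] M(2)[OF that, of "Suc j"] by linarith
    then show ?thesis
      using that b_nonzero[of j] by (simp add: b'_def field_simps)
  qed
  have "b' j \<in> pts (dual_closed_span smul b)" for j
    by (rule bounded_functional_S_I[OF _ _ bound])
      (auto simp: b'_def coef_add coef_smul subspace_add[OF subspace_S] subspace_scale[OF subspace_S])
  moreover have "b' j (b i) = (if i = j then 1 else 0)" for i j
    by (simp add: b'_def b_in_S coef_b)
  ultimately have "biorthogonal_functionals smul b b'"
    by (auto simp: biorthogonal_functionals_def)
  then show ?thesis
    by blast
qed

text \<open>\<open>b' j\<close> agrees with the coordinate functional on \<open>proj n x\<close>
  once \<open>n > j\<close>, and continuity carries this to the limit \<open>x\<close>.\<close>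

lemma biorthogonal_eq_coef:
  assumes "biorthogonal_functionals smul b b'" and "x \<in> S"
  shows "b' j x = coef x j"
proof -
  have b': "b' j \<in> pts (dual_closed_span smul b)" and b'_b: "\<And>i. b' j (b i) = (if i = j then 1 else 0)"
    using assms(1) by (auto simp: biorthogonal_functionals_def)
  from b' have add: "\<And>x y. x \<in> S \<Longrightarrow> y \<in> S \<Longrightarrow> b' j (x + y) = b' j x + b' j y"
    and scale: "\<And>c x. x \<in> S \<Longrightarrow> b' j (smul c x) = c * b' j x"
    unfolding bounded_functional_S_iff by auto
  from b' obtain K where K: "\<And>x. x \<in> S \<Longrightarrow> norm (b' j x) \<le> K * norm x"
    unfolding bounded_functional_S_iff by blast
  have proj_S: "proj n x \<in> S" for n
    unfolding proj_def by (intro subspace_sum subspace_scale subspace_S b_in_S)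
  have zero: "b' j 0 = 0"
    using scale[OF b_in_S, of 0] by simp
  have "b' j (proj n x) = (\<Sum>i<n. coef x i * b' j (b i))" for n
    unfolding proj_def
    by (induction n)
      (auto simp: zero add scale b_in_S subspace_scale[OF subspace_S] subspace_sum[OF subspace_S])
  then have eq: "b' j (proj n x) = coef x j" if "n > j" for n
    using that by (simp add: b'_b if_distrib sum.delta cong: if_cong)
  have "(\<lambda>n. b' j (x - proj n x)) \<longlonglongrightarrow> 0"
  proof (rule Lim_null_comparison)
    show "\<forall>\<^sub>F n in sequentially. norm (b' j (x - proj n x)) \<le> K * norm (x - proj n x)"
      using K subspace_diff[OF subspace_S assms(2) proj_S] by simp
    show "(\<lambda>n. K * norm (x - proj n x)) \<longlonglongrightarrow> 0"
      using tendsto_mult[OF tendsto_const[of K] tendsto_norm[OF tendsto_diff[OF tendsto_const[of x] proj_tendsto[OF assms(2)]]]]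
      by simp
  qed
  moreover have "\<forall>\<^sub>F n in sequentially. b' j (x - proj n x) = b' j x - coef x j"
    using eventually_gt_at_top[of j]
  proof eventually_elim
    case (elim n)
    have "b' j (x - proj n x) + b' j (proj n x) = b' j x"
      using add[OF subspace_diff[OF subspace_S assms(2) proj_S] proj_S, of n n] by simp
    then show ?case
      using eq[OF elim] by (simp add: algebra_simps)
  qed
  ultimately have "(\<lambda>n::nat. b' j x - coef x j) \<longlonglongrightarrow> 0"
    by (simp add: tendsto_cong)
  then show ?thesis
    by (simp add: LIMSEQ_const_iff)
qed

end

subsection \<open>The dual of the closed span\<close>

text \<open>
  The scalar field enters only through the two forms of the Hahn-Banach theorem assumed here. The
  functional \<open>u\<close> in the second one is real-linear, so that it is the real part of \<open>g\<close> over the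
  complex numbers.
\<close>

locale hahn_banach_basic_sequence = basic_sequence_in_banach smul b
  for smul :: "'k::{real_normed_field, banach} \<Rightarrow> 'a::banach \<Rightarrow> 'a" and b +
  assumes extension: "subspace V \<Longrightarrow> bounded_functional (space_on smul V) f \<Longrightarrow>
      \<exists>g. bounded_functional (space_on smul UNIV) g \<and> (\<forall>x\<in>V. g x = f x)"
    and domination: "linear u \<Longrightarrow> (\<And>x. \<bar>u x :: real\<bar> \<le> K * norm x) \<Longrightarrow>
      \<exists>g. bounded_functional (space_on smul UNIV) g \<and>
        (\<forall>x. \<bar>u x\<bar> \<le> norm (g x) \<and> norm (g x) \<le> K * norm x)"
begin

abbreviation "D \<equiv> dual_closed_span smul b"

section \<open>Norm and linear structure of the dual\<close>

lemma vnorm_D: "vnorm D f = (SUP x\<in>{x\<in>S. norm x \<le> 1}. norm (f x))"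
  by (simp add: dual_closed_span_def dual_def space_on_def)

lemma vadd_D: "vadd D f g = (\<lambda>x. f x + g x)"
  by (simp add: dual_closed_span_def dual_def)

lemma vscale_D: "vscale D c f = (\<lambda>x. c * f x)"
  by (simp add: dual_closed_span_def dual_def)

lemma zero_in_S: "0 \<in> S"
  by (rule subspace_0[OF subspace_S])

lemma vnorm_le:
  assumes "0 \<le> C" "\<And>x. x \<in> S \<Longrightarrow> norm (f x) \<le> C * norm x"
  shows "vnorm D f \<le> C"
  unfolding vnorm_D
proof (rule cSUP_least)
  show "{x \<in> S. norm x \<le> 1} \<noteq> {}"
    using zero_in_S by force
  show "norm (f x) \<le> C" if "x \<in> {x \<in> S. norm x \<le> 1}" for x
    using assms(2)[of x] that mult_left_le[OF _ \<open>0 \<le> C\<close>, of "norm x"] by auto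
qed

text \<open>A real supremum is informative only for a set bounded above, so this is derived first
  from some bound \<open>K\<close>; the claim is then read off at the normalised vector.\<close>

lemma norm_le_vnorm:
  assumes f: "f \<in> pts D" and x: "x \<in> S"
  shows "norm (f x) \<le> vnorm D f * norm x"
proof (cases "x = 0")
  case True
  then show ?thesis
    using f zero_in_S by (auto simp: bounded_functional_S_iff)
next
  case False
  obtain K where K: "\<And>x. x \<in> S \<Longrightarrow> norm (f x) \<le> K * norm x"
    using f unfolding bounded_functional_S_iff by blast
  have "norm (f z) \<le> \<bar>K\<bar>" if "z \<in> S" "norm z \<le> 1" for z
  proof -
    have "norm (f z) \<le> \<bar>K\<bar> * norm z"
      using K[OF that(1)] mult_right_mono[OF abs_ge_self, of "norm z" K] by simp
    also have "\<dots> \<le> \<bar>K\<bar>"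
      using that by (simp add: mult_left_le)
    finally show ?thesis .
  qed
  then have "bdd_above ((\<lambda>x. norm (f x)) ` {x \<in> S. norm x \<le> 1})"
    by (intro bdd_aboveI2[where M = "\<bar>K\<bar>"]) auto
  moreover define z where "z = smul (of_real (1 / norm x)) x"
  moreover have "z \<in> {x \<in> S. norm x \<le> 1}"
    unfolding z_def using subspace_scale[OF subspace_S x] False by (simp add: norm_scale norm_divide)
  ultimately have "norm (f z) \<le> vnorm D f"
    unfolding vnorm_D by (intro cSUP_upper)
  moreover have "norm (f z) = norm (f x) / norm x"
    using f x by (auto simp: z_def bounded_functional_S_iff norm_mult norm_divide)
  ultimately show ?thesis
    using False by (simp add: field_simps)
qed

lemma vnorm_nonneg:
  assumes "f \<in> pts D"
  shows "0 \<le> vnorm D f"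
proof -
  have "0 \<le> vnorm D f * norm (b 0)"
    using order_trans[OF norm_ge_zero norm_le_vnorm[OF assms b_in_S]] .
  then show ?thesis
    using b_nonzero[of 0] by (simp add: zero_le_mult_iff)
qed

section \<open>Functionals on the dual\<close>

lemma bidual_iff:
  "F \<in> pts (dual D) \<longleftrightarrow>
    (\<forall>f\<in>pts D. \<forall>g\<in>pts D. F (\<lambda>x. f x + g x) = F f + F g) \<and>
    (\<forall>c. \<forall>f\<in>pts D. F (\<lambda>x. c * f x) = c * F f) \<and>
    (\<exists>K. \<forall>f\<in>pts D. norm (F f) \<le> K * vnorm D f) \<and> (\<forall>f. f \<notin> pts D \<longrightarrow> F f = 0)"
  by (simp add: dual_def[of D] bounded_functional_def vadd_D vscale_D)

lemma zero_in_D: "(\<lambda>_. 0) \<in> pts D"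
  by (auto simp: bounded_functional_S_iff intro: exI[of _ 0])

lemma add_in_D:
  assumes f: "f \<in> pts D" and g: "g \<in> pts D"
  shows "(\<lambda>x. f x + g x) \<in> pts D"
proof -
  have bound: "norm (f x + g x) \<le> (vnorm D f + vnorm D g) * norm x" if "x \<in> S" for x
    using norm_triangle_ineq[of "f x" "g x"] norm_le_vnorm[OF f that] norm_le_vnorm[OF g that]
    by (simp add: distrib_right)
  show ?thesis
    by (rule bounded_functional_S_I[OF _ _ bound])
      (use f g in \<open>auto simp: bounded_functional_S_iff algebra_simps\<close>)
qed

lemma scale_in_D:
  assumes f: "f \<in> pts D"
  shows "(\<lambda>x. c * f x) \<in> pts D"
proof -
  have bound: "norm (c * f x) \<le> (norm c * vnorm D f) * norm x" if "x \<in> S" for x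
    using norm_le_vnorm[OF f that] by (simp add: norm_mult mult.assoc mult_left_mono)
  show ?thesis
    by (rule bounded_functional_S_I[OF _ _ bound])
      (use f in \<open>auto simp: bounded_functional_S_iff algebra_simps\<close>)
qed

lemma combination_in_D:
  assumes "finite J" "\<And>j. j \<in> J \<Longrightarrow> g j \<in> pts D"
  shows "(\<lambda>x. \<Sum>j\<in>J. c j * g j x) \<in> pts D"
  using assms by (induction J) (simp_all add: zero_in_D add_in_D scale_in_D)

lemma bidual_combination:
  assumes F: "F \<in> pts (dual D)" and "finite J" "\<And>j. j \<in> J \<Longrightarrow> g j \<in> pts D"
  shows "F (\<lambda>x. \<Sum>j\<in>J. c j * g j x) = (\<Sum>j\<in>J. c j * F (g j))"
  using assms(2,3)
proof (induction J)
  case empty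
  have "\<forall>f\<in>pts D. F (\<lambda>x. 0 * f x) = 0 * F f"
    using F unfolding bidual_iff by blast
  from bspec[OF this zero_in_D] show ?case
    by simp
next
  case (insert j J)
  have "F (\<lambda>x. c j * g j x + (\<Sum>j\<in>J. c j * g j x)) =
      F (\<lambda>x. c j * g j x) + F (\<lambda>x. \<Sum>j\<in>J. c j * g j x)"
    using F insert.prems insert.hyps unfolding bidual_iff
    by (simp add: scale_in_D combination_in_D)
  moreover have "F (\<lambda>x. c j * g j x) = c j * F (g j)"
    using F insert.prems unfolding bidual_iff by blast
  ultimately show ?case
    using insert by simp
qed

lemma sum_in_D:
  assumes "finite J" "\<And>j. j \<in> J \<Longrightarrow> g j \<in> pts D"
  shows "(\<lambda>x. \<Sum>j\<in>J. g j x) \<in> pts D"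
  using combination_in_D[OF assms, where c = "\<lambda>_. 1"] by simp

text \<open>The canonical embedding into the bidual, cut off to 0 outside the carrier as
  \<open>dual\<close> requires. It shows that weak limits in \<open>D\<close> are pointwise limits
  on \<open>S\<close>.\<close>

lemma evaluation_in_bidual:
  assumes "x \<in> S"
  shows "(\<lambda>f. if f \<in> pts D then f x else 0) \<in> pts (dual D)"
  unfolding bidual_iff
  using norm_le_vnorm[OF _ assms] add_in_D scale_in_D
  by (auto simp: mult.commute intro!: exI[of _ "norm x"])

text \<open>At \<open>y\<close> the real norming functional squeezes \<open>norm (g y)\<close>
  between \<open>norm y\<close> and itself. The value \<open>g y\<close> is fixed only in modulus,
  which suffices for norm estimates.\<close>

lemma norming:
  obtains g where "bounded_functional (space_on smul UNIV) g"
    "norm (g y) = norm y" "\<And>x. norm (g x) \<le> norm x"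
proof -
  obtain u :: "'a \<Rightarrow> real" where "linear u" "u y = norm y" "\<And>x. \<bar>u x\<bar> \<le> norm x"
    using norming_functional[of y] by blast
  with domination[of u 1] obtain g where g: "bounded_functional (space_on smul UNIV) g"
      and le: "\<And>x. \<bar>u x\<bar> \<le> norm (g x) \<and> norm (g x) \<le> norm x"
    by auto
  have "norm (g y) = norm y"
    using le[of y] \<open>u y = norm y\<close> by (intro antisym) auto
  then show thesis
    using that g le by blast
qed

section \<open>The partial sums of the biorthogonal functionals\<close>

theorem partial_sums_weak_Cauchy:
  assumes ss: "strongly_summing smul b" and b': "biorthogonal_functionals smul b b'"
  shows "weak_Cauchy D (\<lambda>n x. \<Sum>j\<le>n. b' j x)"
  unfolding weak_Cauchy_def
proof (intro conjI ballI)
  have b'_D: "b' j \<in> pts D" for j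
    using b' by (auto simp: biorthogonal_functionals_def)
  then show "range (\<lambda>n x. \<Sum>j\<le>n. b' j x) \<subseteq> pts D"
    using sum_in_D by blast
  fix F assume F: "F \<in> pts (dual D)"
  obtain M where M: "0 \<le> M" "\<And>n x. x \<in> S \<Longrightarrow> norm (proj n x) \<le> M * norm x"
    using proj_bounded by blast
  obtain K where K: "\<And>f. f \<in> pts D \<Longrightarrow> norm (F f) \<le> K * vnorm D f"
    using F unfolding bidual_iff by blast
  have "norm (\<Sum>j\<le>n. smul (F (b' j)) (b j)) \<le> \<bar>K\<bar> * M" for n
  proof -
    define y where "y = (\<Sum>j\<le>n. smul (F (b' j)) (b j))"
    obtain g where g: "bounded_functional (space_on smul UNIV) g"
        and g_y: "norm (g y) = norm y" and g_le: "\<And>x. norm (g x) \<le> norm x"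
      using norming[of y] by blast
    have g_add: "g (x + z) = g x + g z" and g_scale: "g (smul c x) = c * g x" for x z c
      using g by (simp_all add: bounded_functional_def space_on_def)
    have "g 0 = 0"
      using g_scale[of 0 0] by simp
    then have g_sum: "g (\<Sum>j\<in>J. smul (c j) (b j)) = (\<Sum>j\<in>J. c j * g (b j))" for c and J :: "nat set"
      by (induction J rule: infinite_finite_induct) (simp_all add: g_add g_scale)
    \<comment> \<open>On \<open>S\<close> this is \<open>g\<close> composed with
      \<open>proj (Suc n)\<close>; written as a combination of the \<open>b' j\<close> it vanishes
      off \<open>S\<close>, and \<open>F\<close> can be applied term by term.\<close>
    define h where "h x = (\<Sum>j\<le>n. g (b j) * b' j x)" for x
    have h_D: "h \<in> pts D"
      unfolding h_def using b'_D by (intro combination_in_D) auto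
    have "norm (h x) \<le> M * norm x" if "x \<in> S" for x
    proof -
      have "h x = g (proj (Suc n) x)"
        by (simp add: h_def proj_def g_sum biorthogonal_eq_coef[OF b' that] lessThan_Suc_atMost mult.commute
            del: sum.lessThan_Suc)
      then show ?thesis
        using g_le[of "proj (Suc n) x"] M(2)[OF that, of "Suc n"] by simp
    qed
    then have "vnorm D h \<le> M"
      using M(1) by (intro vnorm_le)
    have "F h = (\<Sum>j\<le>n. g (b j) * F (b' j))"
      unfolding h_def using b'_D by (intro bidual_combination[OF F]) auto
    also have "\<dots> = g y"
      by (simp add: y_def g_sum mult.commute)
    finally have "norm y = norm (F h)"
      by (simp add: g_y)
    also have "\<dots> \<le> \<bar>K\<bar> * vnorm D h"
      using K[OF h_D] mult_right_mono[OF abs_ge_self vnorm_nonneg[OF h_D], of K] by simp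
    also have "\<dots> \<le> \<bar>K\<bar> * M"
      using \<open>vnorm D h \<le> M\<close> by (intro mult_left_mono) auto
    finally show ?thesis
      by (simp add: y_def)
  qed
  then have bdd: "bdd_above (range (\<lambda>n. norm (\<Sum>j\<le>n. smul (F (b' j)) (b j))))"
    by (intro bdd_aboveI2)
  have "\<forall>c. bdd_above (range (\<lambda>n. norm (\<Sum>j\<le>n. smul (c j) (b j)))) \<longrightarrow> summable c"
    using ss by (simp add: strongly_summing_def)
  from this[rule_format, OF bdd] have "summable (\<lambda>j. F (b' j))" .
  moreover have "F (\<lambda>x. \<Sum>j\<le>n. b' j x) = (\<Sum>j\<le>n. F (b' j))" for n
    using bidual_combination[OF F, of "{..n}" b' "\<lambda>_. 1"] b'_D by simp
  ultimately show "convergent (\<lambda>n. F (\<lambda>x. \<Sum>j\<le>n. b' j x))"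
    by (simp add: summable_iff_convergent')
qed

text \<open>Uniform boundedness was shown for real functionals, while weak-Cauchy speaks of
  functionals over \<open>'k\<close>; \<open>domination\<close> bounds \<open>u (b n)\<close> by the
  convergent, hence bounded, \<open>g (b n)\<close>.\<close>

lemma weak_Cauchy_bounded:
  assumes "weak_Cauchy (space_on smul UNIV) b"
  shows "bounded (range b)"
proof (rule weakly_bounded_imp_bounded)
  fix u :: "'a \<Rightarrow> real" assume u: "bounded_linear u"
  then obtain K where "\<And>x. \<bar>u x\<bar> \<le> K * norm x"
    using bounded_linear.bounded[OF u] by (auto simp: mult.commute)
  then obtain g where g: "bounded_functional (space_on smul UNIV) g" and le: "\<And>x. \<bar>u x\<bar> \<le> norm (g x)"
    using domination[OF bounded_linear.linear[OF u]] by metis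
  then have "convergent (\<lambda>n. g (b n))"
    using assms by (auto simp: weak_Cauchy_def dual_def)
  from convergent_imp_Bseq[OF this] obtain C where "\<And>n. norm (g (b n)) \<le> C"
    by (auto simp: Bseq_def)
  then show "bounded (range (\<lambda>n. u (b n)))"
    using order_trans[OF le] by (auto simp: bounded_iff)
qed

theorem partial_sums_not_weakly_convergent:
  assumes wC: "weak_Cauchy (space_on smul UNIV) b" and b': "biorthogonal_functionals smul b b'"
  shows "\<not> weakly_convergent D (\<lambda>n x. \<Sum>j\<le>n. b' j x)"
proof
  define s where "s n x = (\<Sum>j\<le>n. b' j x)" for n x
  have b'_b: "b' j (b i) = (if i = j then 1 else 0)" for i j
    using b' by (simp add: biorthogonal_functionals_def)
  then have s_b: "s n (b i) = (if i \<le> n then 1 else 0)" for n i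
    by (simp add: s_def)
  have s_D: "s n \<in> pts D" for n
    unfolding s_def using b' by (intro sum_in_D) (auto simp: biorthogonal_functionals_def)
  assume "weakly_convergent D (\<lambda>n x. \<Sum>j\<le>n. b' j x)"
  then obtain l where l: "l \<in> pts D" and lim: "\<And>F. F \<in> pts (dual D) \<Longrightarrow> (\<lambda>n. F (s n)) \<longlonglongrightarrow> F l"
    unfolding weakly_convergent_def s_def[abs_def] by blast
  have l_b: "l (b i) = 1" for i
  proof -
    have "(\<lambda>n. s n (b i)) \<longlonglongrightarrow> l (b i)"
      using lim[OF evaluation_in_bidual[OF b_in_S, of i]] l s_D by simp
    moreover have "(\<lambda>n. s n (b i)) \<longlonglongrightarrow> 1"
      by (rule tendsto_eventually) (auto simp: s_b eventually_sequentially)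
    ultimately show ?thesis
      by (rule LIMSEQ_unique)
  qed
  \<comment> \<open>Members of \<open>D\<close> live on \<open>S\<close>, but \<open>b\<close> is
    weak-Cauchy in the ambient space; Hahn-Banach extension bridges the two.\<close>
  have conv: "convergent (\<lambda>j. f (b j))" if f: "f \<in> pts D" for f
  proof -
    have "bounded_functional (space_on smul S) f"
      using f by (simp add: dual_closed_span_def dual_def)
    then obtain g where "bounded_functional (space_on smul UNIV) g" "\<And>x. x \<in> S \<Longrightarrow> g x = f x"
      using extension[OF subspace_S] by blast
    then show ?thesis
      using wC b_in_S by (auto simp: weak_Cauchy_def dual_def)
  qed
  define F where "F f = (if f \<in> pts D then Topological_Spaces.lim (\<lambda>j. f (b j)) else 0)" for f
  have F_lim: "(\<lambda>j. f (b j)) \<longlonglongrightarrow> F f" if "f \<in> pts D" for f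
    using conv[OF that] that by (simp add: F_def convergent_LIMSEQ_iff)
  have F_eq: "F f = c" if "f \<in> pts D" "(\<lambda>j. f (b j)) \<longlonglongrightarrow> c" for f c
    using F_lim that LIMSEQ_unique by blast
  obtain B where B: "\<And>j. norm (b j) \<le> B"
    using weak_Cauchy_bounded[OF wC] by (auto simp: bounded_iff)
  have F_bound: "norm (F f) \<le> B * vnorm D f" if f: "f \<in> pts D" for f
  proof (rule LIMSEQ_le_const2[OF tendsto_norm[OF F_lim[OF f]]])
    have "norm (f (b j)) \<le> B * vnorm D f" for j
      using norm_le_vnorm[OF f b_in_S, of j] mult_left_mono[OF B[of j] vnorm_nonneg[OF f]]
      by (simp add: mult.commute)
    then show "\<exists>N. \<forall>j\<ge>N. norm (f (b j)) \<le> B * vnorm D f"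
      by blast
  qed
  have "F \<in> pts (dual D)"
    unfolding bidual_iff
  proof (intro conjI ballI allI exI impI)
    show "F (\<lambda>x. f x + g x) = F f + F g" if "f \<in> pts D" "g \<in> pts D" for f g
      using that by (intro F_eq add_in_D tendsto_add F_lim)
    show "F (\<lambda>x. c * f x) = c * F f" if "f \<in> pts D" for c f
      using that by (intro F_eq scale_in_D tendsto_mult tendsto_const F_lim)
    show "norm (F f) \<le> B * vnorm D f" if "f \<in> pts D" for f
      using that by (rule F_bound)
    show "F f = 0" if "f \<notin> pts D" for f
      using that by (simp add: F_def)
  qed
  then have "(\<lambda>n. F (s n)) \<longlonglongrightarrow> F l"
    by (rule lim)
  \<comment> \<open>\<open>s n (b j)\<close> vanishes for all \<open>j > n\<close>, whereas
    \<open>l (b j)\<close> is constantly 1.\<close>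
  moreover have "F (s n) = 0" for n
    by (intro F_eq s_D tendsto_eventually)
      (auto simp: s_b eventually_sequentially intro!: exI[of _ "Suc n"])
  moreover have "F l = 1"
    by (intro F_eq l) (simp add: l_b)
  ultimately show False
    by (simp add: LIMSEQ_const_iff)
qed

theorem strongly_summing_dual:
  assumes "strongly_summing smul b"
  shows "(\<forall>b'. biorthogonal_functionals smul b b' \<longrightarrow>
      nontrivial_weak_Cauchy D (\<lambda>n x. \<Sum>j\<le>n. b' j x)) \<and> \<not> weakly_sequentially_complete D"
proof -
  have "nontrivial_weak_Cauchy D (\<lambda>n x. \<Sum>j\<le>n. b' j x)" if "biorthogonal_functionals smul b b'" for b'
    using partial_sums_weak_Cauchy[OF assms that] partial_sums_not_weakly_convergent[OF _ that] assms
    by (simp add: nontrivial_weak_Cauchy_def strongly_summing_def)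
  then show ?thesis
    using ex_biorthogonal_functionals
    unfolding nontrivial_weak_Cauchy_def weakly_sequentially_complete_def by blast
qed

end

subsection \<open>Real and complex scalars\<close>

lemma real_hahn_banach_basic_sequence:
  fixes b :: "nat \<Rightarrow> 'a::banach"
  assumes "basic_sequence ((*\<^sub>R) :: real \<Rightarrow> 'a \<Rightarrow> 'a) b"
  shows "hahn_banach_basic_sequence ((*\<^sub>R) :: real \<Rightarrow> 'a \<Rightarrow> 'a) b"
proof unfold_locales
  fix V and f :: "'a \<Rightarrow> real"
  assume V: "module.subspace (*\<^sub>R) V" and f: "bounded_functional (space_on (*\<^sub>R) V) f"
  obtain K where K: "\<And>x. x \<in> V \<Longrightarrow> norm (f x) \<le> K * norm x"
    using f unfolding bounded_functional_def space_on_def by force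
  have "\<bar>f x\<bar> \<le> \<bar>K\<bar> * norm x" if "x \<in> V" for x
    using K[OF that] mult_right_mono[OF abs_ge_self, of "norm x" K] by simp
  moreover have "subspace V"
    using V by (simp add: subspace_raw_def)
  ultimately obtain g where "linear g" "\<And>x. x \<in> V \<Longrightarrow> g x = f x" "\<And>x. \<bar>g x\<bar> \<le> \<bar>K\<bar> * norm x"
    using f norm_Hahn_Banach[of V "\<bar>K\<bar>" f] by (auto simp: bounded_functional_def space_on_def)
  then show "\<exists>g. bounded_functional (space_on (*\<^sub>R) UNIV) g \<and> (\<forall>x\<in>V. g x = f x)"
    by (intro exI[of _ g]) (auto simp: bounded_functional_def space_on_def linear_add linear_scale)
next
  fix u :: "'a \<Rightarrow> real" and K
  assume "linear u" "\<And>x. \<bar>u x\<bar> \<le> K * norm x"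
  then show "\<exists>g. bounded_functional (space_on (*\<^sub>R) UNIV) g \<and>
      (\<forall>x. \<bar>u x\<bar> \<le> norm (g x) \<and> norm (g x) \<le> K * norm x)"
    by (intro exI[of _ u]) (auto simp: bounded_functional_def space_on_def linear_add linear_scale)
qed (use assms in \<open>auto simp: scaleR_add_left scaleR_add_right\<close>)

text \<open>A complex functional is determined by its real part through
  \<open>g x = u x - \<i> * u (\<i> x)\<close>, and it inherits the bound because a rotation of
  \<open>x\<close> makes its value real and nonnegative.\<close>

lemma complexification:
  fixes smul :: "complex \<Rightarrow> 'a::real_normed_vector \<Rightarrow> 'a" and u :: "'a \<Rightarrow> real"
  assumes "normed_scaling smul" and u: "linear u" and u_le: "\<And>x. \<bar>u x\<bar> \<le> K * norm x"
  defines "g \<equiv> \<lambda>x. Complex (u x) (- u (smul \<i> x))"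
  shows "bounded_functional (space_on smul UNIV) g" and "\<And>x. norm (g x) \<le> K * norm x"
proof -
  interpret normed_scaling smul
    by fact
  have add: "g (x + y) = g x + g y" for x y
    by (simp add: g_def scale_right_distrib linear_add[OF u] complex_eq_iff)
  have scale: "g (smul c x) = c * g x" for c x
  proof -
    \<comment> \<open>Since \<open>u\<close> is only real-linear, \<open>c\<close> is split so that
      \<open>scale_of_real\<close> turns its parts into real scalings.\<close>
    have "c = of_real (Re c) + of_real (Im c) * \<i>"
      by (simp add: complex_eq_iff)
    then have c: "smul c x = Re c *\<^sub>R x + Im c *\<^sub>R smul \<i> x"
      by (metis scale_left_distrib scale_scale scale_of_real)
    have "\<i> * c = of_real (Re c) * \<i> + of_real (- Im c)"
      by (simp add: complex_eq_iff)
    then have "smul \<i> (smul c x) = Re c *\<^sub>R smul \<i> x + (- Im c) *\<^sub>R x"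
      by (metis scale_left_distrib scale_scale scale_of_real)
    then show ?thesis
      by (simp add: g_def c complex_eq_iff linear_add[OF u] linear_scale[OF u] linear_diff[OF u] linear_neg[OF u])
  qed
  show bound: "norm (g x) \<le> K * norm x" for x
  proof (cases "g x = 0")
    case True
    then show ?thesis
      using u_le[of x] by simp
  next
    case False
    \<comment> \<open>The unimodular factor that turns \<open>g x\<close> into its modulus; there
      the value is real and equals \<open>u (smul c x)\<close>.\<close>
    define c where "c = cnj (g x) / norm (g x)"
    have "norm c = 1"
      using False by (simp add: c_def norm_divide)
    have "c * g x = norm (g x)"
      using False by (simp add: c_def complex_norm_square[symmetric] power2_eq_square mult.commute)
    then have "norm (g x) = Re (g (smul c x))"
      by (simp add: scale)
    also have "\<dots> \<le> K * norm (smul c x)"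
      using u_le[of "smul c x"] by (simp add: g_def)
    finally show ?thesis
      by (simp add: norm_scale \<open>norm c = 1\<close>)
  qed
  show "bounded_functional (space_on smul UNIV) g"
    using add scale bound by (auto simp: bounded_functional_def space_on_def)
qed

lemma complex_hahn_banach_basic_sequence:
  fixes smul :: "complex \<Rightarrow> 'a::banach \<Rightarrow> 'a"
  assumes smul: "normed_scaling smul" and "basic_sequence smul b"
  shows "hahn_banach_basic_sequence smul b"
proof -
  interpret normed_scaling smul
    by fact
  show ?thesis
  proof unfold_locales
    fix V f
    assume V: "subspace V" and f: "bounded_functional (space_on smul V) f"
    obtain K where K: "\<And>x. x \<in> V \<Longrightarrow> norm (f x) \<le> K * norm x"
      using f unfolding bounded_functional_def space_on_def by force
    have f_add: "\<And>x y. x \<in> V \<Longrightarrow> y \<in> V \<Longrightarrow> f (x + y) = f x + f y"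
      and f_scale: "\<And>c x. x \<in> V \<Longrightarrow> f (smul c x) = c * f x"
      using f by (auto simp: bounded_functional_def space_on_def)
    have "\<bar>Re (f x)\<bar> \<le> \<bar>K\<bar> * norm x" if "x \<in> V" for x
      using abs_Re_le_cmod[of "f x"] K[OF that] mult_right_mono[OF abs_ge_self, of "norm x" K] by simp
    moreover have "Re (f (r *\<^sub>R x)) = r * Re (f x)" if "x \<in> V" for r x
      using f_scale[OF that, of "of_real r"] by (simp add: scale_of_real)
    ultimately obtain u where u: "linear u" "\<And>x. x \<in> V \<Longrightarrow> u x = Re (f x)"
        "\<And>x. \<bar>u x\<bar> \<le> \<bar>K\<bar> * norm x"
      by (elim norm_Hahn_Banach[OF subspace_imp_real_subspace[OF V], of "\<bar>K\<bar>" "\<lambda>x. Re (f x)", rotated -1])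
        (simp_all add: f_add)
    \<comment> \<open>On \<open>V\<close>, \<open>- Re (\<i> * f x)\<close> is
      \<open>Im (f x)\<close>, so complexifying the extension of the real part recovers
      \<open>f\<close>.\<close>
    have "Complex (u x) (- u (smul \<i> x)) = f x" if "x \<in> V" for x
      using that subspace_scale[OF V that, of \<i>] by (simp add: u(2) f_scale complex_eq_iff)
    then show "\<exists>g. bounded_functional (space_on smul UNIV) g \<and> (\<forall>x\<in>V. g x = f x)"
      using complexification(1)[OF smul u(1,3)] by blast
  next
    fix u :: "'a \<Rightarrow> real" and K
    assume u: "linear u" "\<And>x. \<bar>u x\<bar> \<le> K * norm x"
    have "\<bar>u x\<bar> \<le> norm (Complex (u x) (- u (smul \<i> x)))" for x
      using abs_Re_le_cmod[of "Complex (u x) (- u (smul \<i> x))"] by simp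
    then show "\<exists>g. bounded_functional (space_on smul UNIV) g \<and>
        (\<forall>x. \<bar>u x\<bar> \<le> norm (g x) \<and> norm (g x) \<le> K * norm x)"
      using complexification[OF smul u] by blast
  qed (use assms in auto)
qed

theorem proposition1p4:
  fixes b :: "nat \<Rightarrow> 'a::banach"
    and scaleC :: "complex \<Rightarrow> 'b::banach \<Rightarrow> 'b" and d :: "nat \<Rightarrow> 'b"
  shows
    "(strongly_summing ((*\<^sub>R) :: real \<Rightarrow> 'a \<Rightarrow> 'a) b \<longrightarrow>
        (\<forall>b'. biorthogonal_functionals (*\<^sub>R) b b' \<longrightarrow>
           nontrivial_weak_Cauchy (dual_closed_span (*\<^sub>R) b) (\<lambda>n x. \<Sum>j\<le>n. b' j x)) \<and>
        \<not> weakly_sequentially_complete (dual_closed_span (*\<^sub>R) b)) \<and>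
     (normed_scaling scaleC \<and> strongly_summing scaleC d \<longrightarrow>
        (\<forall>d'. biorthogonal_functionals scaleC d d' \<longrightarrow>
           nontrivial_weak_Cauchy (dual_closed_span scaleC d) (\<lambda>n x. \<Sum>j\<le>n. d' j x)) \<and>
        \<not> weakly_sequentially_complete (dual_closed_span scaleC d))"
proof (intro conjI[of "_ \<longrightarrow> _"] impI)
  assume b: "strongly_summing ((*\<^sub>R) :: real \<Rightarrow> 'a \<Rightarrow> 'a) b"
  then interpret hahn_banach_basic_sequence "(*\<^sub>R) :: real \<Rightarrow> 'a \<Rightarrow> 'a" b
    by (intro real_hahn_banach_basic_sequence) (simp add: strongly_summing_def)
  show "(\<forall>b'. biorthogonal_functionals (*\<^sub>R) b b' \<longrightarrow>
      nontrivial_weak_Cauchy D (\<lambda>n x. \<Sum>j\<le>n. b' j x)) \<and> \<not> weakly_sequentially_complete D"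
    by (rule strongly_summing_dual[OF b])
next
  assume d: "normed_scaling scaleC \<and> strongly_summing scaleC d"
  then interpret hahn_banach_basic_sequence scaleC d
    by (intro complex_hahn_banach_basic_sequence) (simp_all add: strongly_summing_def)
  show "(\<forall>d'. biorthogonal_functionals scaleC d d' \<longrightarrow>
      nontrivial_weak_Cauchy D (\<lambda>n x. \<Sum>j\<le>n. d' j x)) \<and> \<not> weakly_sequentially_complete D"
    using d by (intro strongly_summing_dual) simp
qed

end
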